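(* Let $s \geq 1$ and $t \geq 2$ be integers and let $\alpha_{s,t}$ be the type-$\alpha$ comb with $s$ teeth of length $t$. Then the number of linear extensions of $\alpha_{s,t}$ that avoid both patterns $213$ and $321$ equals $\binom{s}{2}+1$.
   Context: A linear extension of a finite poset $P$ on a set of integers is a listing $v=[v_1,\dots,v_n]$ of all elements of $P$, each exactly once, such that whenever $a \leq_P b$, $a$ appears before $b$. For $w \in S_3$, a sequence $v$ of distinct integers contains $w$ if there are indices $i<j<k$ with $(v_i,v_j,v_k)$ in the same relative order as $(w_1,w_2,w_3)$; otherwise $v$ avoids $w$. The type-$\alpha$ comb $\alpha_{s,t}$ is the poset on $\{1,\dots,st\}$ whose order is generated by the relations $i \leq i+1$ for $1 \leq i \leq s-1$ (the spine $1,\dots,s$) and $x \leq x+s$ for $1 \leq x \leq (t-1)s$ (so the teeth are $c, c+s, \dots, c+(t-1)s$ for $1\le c\le s$). *)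

theory Defs
  imports Main
begin

text \<open>
  A poset is given by its carrier \<open>A\<close> and its reflexive order relation \<open>r\<close>.  Since \<open>r\<close> is
  reflexive, ``appears before'' is the non-strict comparison of positions.
\<close>
definition linear_extensions :: "'a set \<Rightarrow> ('a \<times> 'a) set \<Rightarrow> 'a list set" where
  "linear_extensions A r =
     {v. distinct v \<and> set v = A \<and>
         (\<forall>i<length v. \<forall>j<length v. (v ! i, v ! j) \<in> r \<longrightarrow> i \<le> j)}"

definition same_relative_order :: "'a::linorder list \<Rightarrow> 'b::linorder list \<Rightarrow> bool" where
  "same_relative_order xs ys \<longleftrightarrow>
     length xs = length ys \<and>
     (\<forall>p<length xs. \<forall>q<length xs. xs ! p < xs ! q \<longleftrightarrow> ys ! p < ys ! q)"

text \<open>Patterns of length three only, in one-line notation, e.g. \<open>[2, 1, 3]\<close>.\<close>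
definition contains_pattern :: "'a::linorder list \<Rightarrow> nat list \<Rightarrow> bool" where
  "contains_pattern v w \<longleftrightarrow>
     (\<exists>i j k. i < j \<and> j < k \<and> k < length v \<and> same_relative_order [v ! i, v ! j, v ! k] w)"

definition avoids_pattern :: "'a::linorder list \<Rightarrow> nat list \<Rightarrow> bool" where
  "avoids_pattern v w \<longleftrightarrow> \<not> contains_pattern v w"

definition comb_carrier :: "nat \<Rightarrow> nat \<Rightarrow> nat set" where
  "comb_carrier s t = {1..s * t}"

definition comb_generators :: "nat \<Rightarrow> nat \<Rightarrow> (nat \<times> nat) set" where
  "comb_generators s t =
     {(i, i + 1) | i. 1 \<le> i \<and> i \<le> s - 1} \<union>
     {(x, x + s) | x. 1 \<le> x \<and> x \<le> (t - 1) * s}"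

text \<open>
  \<open>rtrancl\<close> is reflexive on all of \<open>nat\<close>; the intersection cuts the order down to the carrier.
\<close>
definition comb_order :: "nat \<Rightarrow> nat \<Rightarrow> (nat \<times> nat) set" where
  "comb_order s t = (comb_generators s t)\<^sup>* \<inter> comb_carrier s t \<times> comb_carrier s t"

lemma comb_generators_rtrancl_le:
  "(a, b) \<in> (comb_generators s t)\<^sup>* \<Longrightarrow> a \<le> b"
  by (induction rule: rtrancl_induct) (auto simp: comb_generators_def)

lemma comb_generators_subset:
  assumes "t \<ge> 1"
  shows "comb_generators s t \<subseteq> comb_carrier s t \<times> comb_carrier s t"
proof -
  obtain t' where t: "t = Suc t'"
    using assms by (cases t) auto
  show ?thesis
    unfolding t comb_generators_def comb_carrier_def
    by (auto simp: algebra_simps intro: trans_le_add1)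
qed

lemma partial_order_on_comb_order:
  "partial_order_on (comb_carrier s t) (comb_order s t)"
  unfolding partial_order_on_def preorder_on_def
proof (intro conjI)
  show "comb_order s t \<subseteq> comb_carrier s t \<times> comb_carrier s t"
    by (auto simp: comb_order_def)
  show "refl_on (comb_carrier s t) (comb_order s t)"
    by (auto simp: comb_order_def refl_on_def)
  show "trans (comb_order s t)"
    by (auto simp: comb_order_def intro!: transI)
  show "antisym (comb_order s t)"
    by (auto simp: comb_order_def intro!: antisymI dest!: comb_generators_rtrancl_le)
qed

lemma finite_linear_extensions:
  assumes "finite A"
  shows "finite (linear_extensions A r)"
proof (rule finite_subset)
  show "linear_extensions A r \<subseteq> {v. set v \<subseteq> A \<and> length v = card A}"
    by (auto simp: linear_extensions_def distinct_card)
  show "finite {v. set v \<subseteq> A \<and> length v = card A}"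
    using assms by (rule finite_lists_length_eq)
qed

end

theory Submission
  imports Defs
begin

text \<open>
  A permutation of \<open>{1..n}\<close> avoiding 213 and 321 increases before the entry \<open>n\<close> and after it, and
  the entries after \<open>n\<close> form an interval, since an entry before \<open>n\<close> lying strictly between two of
  them would play the 2 of a 213.  Hence it is the identity or arises from it by exchanging the
  blocks \<open>{k+1..m}\<close> and \<open>{m+1..n}\<close> for some \<open>k < m < n\<close>.

  Let \<open>n = s t\<close>.  If \<open>k < n - s\<close>, then \<open>x < x + s\<close> for the comb, with
  \<open>x = max (k + 1) (m + 1 - s)\<close>, links the two blocks (for \<open>m < s\<close> the spine links \<open>m\<close> and
  \<open>m + 1\<close>).  If \<open>k \<ge> n - s\<close>, the exchanged elements of the first block are ends of teeth, hence
  maximal.  So exactly the pairs \<open>n - s \<le> k < m < n\<close> are admissible.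
\<close>

text \<open>Two of the comparisons force the others by transitivity. The last one is negated and
  made the conclusion, so the criterion applies as a rule to a chosen triple of positions.\<close>

lemma avoids_213_iff:
  "avoids_pattern v [2, 1, 3] \<longleftrightarrow>
     (\<forall>i j k. i < j \<longrightarrow> j < k \<longrightarrow> k < length v \<longrightarrow> v ! j < v ! i \<longrightarrow> v ! k \<le> v ! i)"
proof -
  have "same_relative_order [a, b, c] [2, 1, 3 :: nat] \<longleftrightarrow> b < a \<and> a < c" for a b c :: 'a
    by (auto simp: same_relative_order_def All_less_Suc2)
  then show ?thesis
    by (simp only: avoids_pattern_def contains_pattern_def not_le [symmetric]) blast
qed

lemma avoids_321_iff:
  "avoids_pattern v [3, 2, 1] \<longleftrightarrow>
     (\<forall>i j k. i < j \<longrightarrow> j < k \<longrightarrow> k < length v \<longrightarrow> v ! j < v ! i \<longrightarrow> v ! j \<le> v ! k)"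
proof -
  have "same_relative_order [a, b, c] [3, 2, 1 :: nat] \<longleftrightarrow> c < b \<and> b < a" for a b c :: 'a
    by (auto simp: same_relative_order_def All_less_Suc2)
  then show ?thesis
    by (simp only: avoids_pattern_def contains_pattern_def not_le [symmetric]) blast
qed

text \<open>The degenerate cases \<open>k = m\<close> and \<open>m = n\<close> give the
  identity.\<close>

definition block_swap :: "nat \<Rightarrow> nat \<Rightarrow> nat \<Rightarrow> nat list" where
  "block_swap n k m = [1..<Suc k] @ [Suc m..<Suc n] @ [Suc k..<Suc m]"

context
  fixes n k m :: nat
  assumes km: "k \<le> m" "m \<le> n"
begin

lemma length_block_swap: "length (block_swap n k m) = n"
  using km by (simp add: block_swap_def del: upt_Suc)

lemma nth_block_swap:
  assumes "i < n"
  shows "block_swap n k m ! i =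
    (if i < k then Suc i else if i + m < n + k then Suc (m + (i - k)) else Suc (i - (n - m)))"
  using assms km by (auto simp: block_swap_def nth_append simp del: upt_Suc)

lemma distinct_block_swap: "distinct (block_swap n k m)"
  using km by (auto simp: block_swap_def simp del: upt_Suc)

lemma set_block_swap: "set (block_swap n k m) = {1..n}"
  using km by (auto simp: block_swap_def simp del: upt_Suc)

text \<open>An inversion pairs an entry above \<open>m\<close> with a later one in
  \<open>{k+1..m}\<close>. Whatever follows lies in the same last block, hence exceeds the smaller
  entry but not the larger one.\<close>

lemma block_swap_avoids:
  "avoids_pattern (block_swap n k m) [2, 1, 3]" "avoids_pattern (block_swap n k m) [3, 2, 1]"
  unfolding avoids_213_iff avoids_321_iff
  using km by (auto simp: length_block_swap nth_block_swap)

end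

lemma block_swap_same: "k \<le> n \<Longrightarrow> block_swap n k k = [1..<Suc n]"
  by (auto simp: list_eq_iff_nth_eq length_block_swap nth_block_swap simp del: upt_Suc)

text \<open>Position \<open>k\<close>, counted from 0, is the first where
  \<open>block_swap n k m\<close> departs from the identity: it holds \<open>m + 1\<close>. If
  \<open>k < k'\<close>, the other list still holds \<open>k + 1\<close> there.\<close>

lemma block_swap_first_eq:
  assumes "block_swap n k m = block_swap n k' m'" "k < m" "m < n" "k' \<le> m'" "m' < n"
  shows "k' \<le> k"
proof (rule ccontr)
  assume "\<not> k' \<le> k"
  moreover have "block_swap n k m ! k = block_swap n k' m' ! k" using assms by simp
  ultimately show False using assms(2-) by (simp add: nth_block_swap)
qed

lemma inj_on_block_swap:
  "inj_on (\<lambda>(k, m). block_swap n k m) {(k, m). k < m \<and> m < n}"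
proof (rule inj_onI, clarify)
  fix k m k' m'
  assume eq: "block_swap n k m = block_swap n k' m'"
    and *: "k < m" "m < n" "k' < m'" "m' < n"
  have "k = k'"
    using block_swap_first_eq[OF eq] block_swap_first_eq[OF eq[symmetric]] * by force
  moreover have "block_swap n k m ! k = block_swap n k' m' ! k" using eq by simp
  ultimately show "k = k' \<and> m = m'" using * by (simp add: nth_block_swap)
qed

lemma block_swap_neq_upt:
  assumes "k < m" "m < n"
  shows "block_swap n k m \<noteq> [1..<Suc n]"
proof
  assume "block_swap n k m = [1..<Suc n]"
  then have "block_swap n k m ! k = [1..<Suc n] ! k" by simp
  then show False using assms by (simp add: nth_block_swap del: upt_Suc)
qed

text \<open>The list is cut at its entry \<open>n\<close>; the tail \<open>B\<close> is the block
  moved to the end, so its least and greatest entries determine \<open>k\<close> and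
  \<open>m\<close>.\<close>

lemma avoiders_are_block_swaps:
  assumes dv: "distinct v" and sv: "set v = {1..n}"
    and p213: "avoids_pattern v [2, 1, 3]" and p321: "avoids_pattern v [3, 2, 1]"
  shows "v = [1..<Suc n] \<or> (\<exists>k m. k < m \<and> m < n \<and> v = block_swap n k m)"
proof (cases "n = 0")
  case True
  then show ?thesis using sv by simp
next
  case False
  then obtain A B where v: "v = A @ n # B"
    using sv split_list[of n v] by auto
  have n_notin: "n \<notin> set A" "n \<notin> set B" and disj: "set A \<inter> set B = {}"
    and dA: "distinct A" and dB: "distinct B"
    using dv v by auto
  have un: "set A \<union> set B \<union> {n} = {1..n}" using sv v by auto
  have lt: "x < n" if "x \<in> set A \<union> set B" for x
  proof -
    have "x \<in> {1..n}" "x \<noteq> n" using that un n_notin by auto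
    then show ?thesis by simp
  qed
  have sA: "sorted A"
    unfolding sorted_iff_nth_mono_less
  proof (intro allI impI)
    fix i j assume ij: "i < j" "j < length A"
    \<comment> \<open>Position \<open>length A\<close> holds \<open>n\<close>, which would complete
      a descent in \<open>A\<close> to a 213.\<close>
    have "n \<le> A ! i" if "A ! j < A ! i"
      using p213[unfolded avoids_213_iff, rule_format, of i j "length A"] ij that
      by (simp add: v nth_append)
    moreover have "A ! i < n" using lt ij by simp
    ultimately show "A ! i \<le> A ! j" by fastforce
  qed
  have sB: "sorted B"
    unfolding sorted_iff_nth_mono_less
  proof (intro allI impI)
    fix i j assume ij: "i < j" "j < length B"
    have "B ! i < n" using lt ij by simp
    \<comment> \<open>Here \<open>n\<close> comes first: followed by a descent in \<open>B\<close>
      it would form a 321.\<close>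
    then show "B ! i \<le> B ! j"
      using p321[unfolded avoids_321_iff, rule_format,
          of "length A" "Suc (length A + i)" "Suc (length A + j)"] ij
      by (simp add: v nth_append)
  qed
  show ?thesis
  proof (cases "B = []")
    case True
    have "v = [1..<Suc n]"
      by (rule sorted_distinct_set_unique)
        (use True sA dv sv v lt in \<open>auto simp: sorted_append less_imp_le simp del: upt_Suc\<close>)
    then show ?thesis ..
  next
    case False
    define lo where "lo = Min (set B)"
    define hi where "hi = Max (set B)"
    have lo: "lo \<in> set B" and hi: "hi \<in> set B" and bnd: "\<And>b. b \<in> set B \<Longrightarrow> lo \<le> b \<and> b \<le> hi"
      using False by (auto simp: lo_def hi_def)
    have "lo \<in> {1..n}" using lo un by auto
    then have lo1: "1 \<le> lo" by simp
    have hin: "hi < n" using hi lt by simp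
    have lohi: "lo \<le> hi" using bnd lo by simp
    have between: "x \<in> set B" if x: "lo \<le> x" "x \<le> hi" for x
    proof (rule ccontr)
      assume nB: "x \<notin> set B"
      have "x \<in> {1..n}" "x \<noteq> n" using x lo1 hin by auto
      then have "x \<in> set A" using nB un by blast
      then obtain i where i: "i < length A" "A ! i = x" by (auto simp: in_set_conv_nth)
      obtain j where j: "j < length B" "B ! j = lo" using lo by (auto simp: in_set_conv_nth)
      obtain l where l: "l < length B" "B ! l = hi" using hi by (auto simp: in_set_conv_nth)
      have xs: "lo < x" "x < hi" using x nB lo hi by (auto simp: order_less_le)
      \<comment> \<open>As \<open>B\<close> is sorted, \<open>lo\<close> precedes \<open>hi\<close>,
        so \<open>x\<close>, \<open>lo\<close>, \<open>hi\<close> occur in this order and form a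
        213.\<close>
      have "j < l"
        using sorted_nth_mono[OF sB, of l j] j l xs by (cases "j < l") auto
      then show False
        using p213[unfolded avoids_213_iff, rule_format,
            of i "Suc (length A + j)" "Suc (length A + l)"] i j l xs
        by (simp add: v nth_append)
    qed
    have "x \<in> set B \<longleftrightarrow> x \<in> {lo..hi}" for x using between[of x] bnd[of x] by auto
    then have setB: "set B = {lo..hi}" by blast
    have "B = [lo..<Suc hi]"
      by (rule sorted_distinct_set_unique) (use sB dB setB in \<open>simp_all add: atLeastLessThanSuc_atLeastAtMost del: upt_Suc\<close>)
    \<comment> \<open>The entry \<open>n\<close> closes the increasing run before \<open>B\<close>,
      so both sides are the sorted list of \<open>{1..n} - {lo..hi}\<close>.\<close>
    moreover have "A @ [n] = [1..<lo] @ [Suc hi..<Suc n]"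
    proof (rule sorted_distinct_set_unique)
      show "sorted (A @ [n])" using sA lt by (auto simp: sorted_append less_imp_le)
      show "distinct (A @ [n])" using dA n_notin by simp
      show "sorted ([1..<lo] @ [Suc hi..<Suc n])" "distinct ([1..<lo] @ [Suc hi..<Suc n])"
        using lohi by (auto simp: sorted_append simp del: upt_Suc)
      have "set (A @ [n]) = {1..n} - set B" using un disj n_notin by auto
      also have "\<dots> = set ([1..<lo] @ [Suc hi..<Suc n])"
        using setB lohi hin lo1 by (auto simp del: upt_Suc)
      finally show "set (A @ [n]) = set ([1..<lo] @ [Suc hi..<Suc n])" .
    qed
    ultimately have "v = block_swap n (lo - 1) hi"
      using lo1 v by (simp add: block_swap_def del: upt_Suc)
    then show ?thesis using lo1 lohi hin by (intro disjI2 exI[of _ "lo - 1"] exI[of _ hi]) auto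
  qed
qed

text \<open>Contrapositive form of the condition; \<open>sorted_wrt\<close> distributes over
  appends, so a block exchange can be tested block by block.\<close>

lemma linear_extensions_iff_sorted_wrt:
  "v \<in> linear_extensions A r \<longleftrightarrow> distinct v \<and> set v = A \<and> sorted_wrt (\<lambda>x y. (y, x) \<notin> r) v"
  unfolding linear_extensions_def sorted_wrt_iff_nth_less
  by (auto simp: not_le) (metis leD less_trans, metis not_le)

lemma upt_linear_extension: "[1..<Suc (s * t)] \<in> linear_extensions (comb_carrier s t) (comb_order s t)"
proof -
  have "sorted_wrt (\<lambda>x y. (y, x) \<notin> comb_order s t) [1..<Suc (s * t)]"
    by (rule sorted_wrt_mono_rel[OF _ sorted_wrt_upt])
      (auto simp: comb_order_def dest: comb_generators_rtrancl_le)
  then show ?thesis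
    by (auto simp: linear_extensions_iff_sorted_wrt comb_carrier_def simp del: upt_Suc)
qed

text \<open>Such an \<open>x\<close> exceeds \<open>(t - 1) * s\<close>, so no tooth relation starts
  at it; this bound is at least \<open>s\<close> because \<open>t \<ge> 2\<close>, so no spine
  relation does either.\<close>

lemma comb_maximal:
  assumes "t \<ge> 2" "s * t - s < x" "(x, y) \<in> comb_order s t"
  shows "y = x"
proof -
  have "(x, z) \<notin> comb_generators s t" for z
  proof -
    obtain u where "t = Suc (Suc u)" using assms(1) by (metis add_2_eq_Suc le_Suc_ex)
    then show ?thesis using assms(2) by (auto simp: comb_generators_def algebra_simps)
  qed
  then show ?thesis
    using assms(3) by (auto simp: comb_order_def elim: converse_rtranclE)
qed

lemma block_swap_linear_extension_iff:
  assumes t: "t \<ge> 2" and km: "k < m" "m < s * t"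
  shows "block_swap (s * t) k m \<in> linear_extensions (comb_carrier s t) (comb_order s t) \<longleftrightarrow>
         s * t - s \<le> k"
proof -
  let ?n = "s * t" and ?r = "comb_order s t"
  have incr: "(y, x) \<notin> ?r" if "x < y" for x y
    using that by (auto simp: comb_order_def dest: comb_generators_rtrancl_le)
  then have "sorted_wrt (\<lambda>x y. (y, x) \<notin> ?r) [a..<b]" for a b
    by (intro sorted_wrt_mono_rel[OF _ sorted_wrt_upt]) auto
  \<comment> \<open>The comb order refines no decreasing pair, so only pairs from the two exchanged
    blocks can violate it.\<close>
  then have iff: "block_swap ?n k m \<in> linear_extensions (comb_carrier s t) ?r \<longleftrightarrow>
      (\<forall>y\<in>{Suc m..?n}. \<forall>x\<in>{Suc k..m}. (x, y) \<notin> ?r)"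
    using km incr
    by (auto simp: linear_extensions_iff_sorted_wrt distinct_block_swap set_block_swap
        comb_carrier_def block_swap_def sorted_wrt_append simp del: upt_Suc)
  have gen: "(x, y) \<in> ?r" if "(x, y) \<in> comb_generators s t" for x y
    using that comb_generators_subset[of t s] t by (auto simp: comb_order_def)
  show ?thesis
  proof (intro iffI)
    assume k: "?n - s \<le> k"
    have "(x, y) \<notin> ?r" if "y \<in> {Suc m..?n}" "x \<in> {Suc k..m}" for x y
      using comb_maximal[OF t, of s x y] k that by auto
    then show "block_swap ?n k m \<in> linear_extensions (comb_carrier s t) ?r"
      unfolding iff by blast
  next
    assume le: "block_swap ?n k m \<in> linear_extensions (comb_carrier s t) ?r"
    show "?n - s \<le> k"
    proof (rule ccontr)
      assume k: "\<not> ?n - s \<le> k"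
      show False
      proof (cases "m < s")
        case True
        then have "(m, Suc m) \<in> comb_generators s t"
          using km by (auto simp: comb_generators_def)
        then show False using gen[of m "Suc m"] le km unfolding iff by auto
      next
        case False
        \<comment> \<open>The first bound puts \<open>x\<close> into \<open>{k+1..m}\<close>, the
          second puts \<open>x + s\<close> above \<open>m\<close>; \<open>k < ?n - s\<close> and
          \<open>m < ?n\<close> keep \<open>x + s\<close> within \<open>?n\<close>.\<close>
        define x where "x = max (Suc k) (Suc m - s)"
        have "0 < s" using km by (cases s) auto
        then have x: "Suc k \<le> x" "x \<le> m" "Suc m \<le> x + s" "x \<le> ?n - s" "x + s \<le> ?n"
          using False k km by (auto simp: x_def)
        have "(t - 1) * s = ?n - s" by (simp add: algebra_simps)
        then have "(x, x + s) \<in> comb_generators s t"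
          using x by (auto simp: comb_generators_def)
        then show False using gen[of x "x + s"] le x unfolding iff by auto
      qed
    qed
  qed
qed

text \<open>Grouping the pairs by \<open>m\<close> gives the sum 0 + 1 + ... + (s - 1).\<close>

lemma card_pairs_less: "card {(k, m). a \<le> k \<and> k < m \<and> m < a + s} = s choose 2" for a s :: nat
proof -
  have "{(k, m). a \<le> k \<and> k < m \<and> m < a + s} = prod.swap ` (SIGMA m:{a..<a + s}. {a..<m})"
    by (force simp: image_iff)
  then have "card {(k, m). a \<le> k \<and> k < m \<and> m < a + s} = (\<Sum>m\<in>{a..<a + s}. m - a)"
    by (simp add: card_image inj_on_def)
  also have "\<dots> = s choose 2"
    by (induction s) (auto simp: numeral_2_eq_2)
  finally show ?thesis .
qed

theorem theorem13:
  fixes s t :: nat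
  assumes "s \<ge> 1" and "t \<ge> 2"
  shows "card {v \<in> linear_extensions (comb_carrier s t) (comb_order s t).
                 avoids_pattern v [2, 1, 3] \<and> avoids_pattern v [3, 2, 1]} = (s choose 2) + 1"
proof -
  define n where "n = s * t"
  define P where "P = {(k, m). n - s \<le> k \<and> k < m \<and> m < n}"
  \<comment> \<open>This makes the truncated difference exact:
    \<open>(n - s) + s = n\<close>.\<close>
  have "s \<le> n" using assms by (simp add: n_def)
  then have cardP: "card P = s choose 2"
    using card_pairs_less[of "n - s" s] by (simp add: P_def)
  have "finite P"
    by (rule finite_subset[of _ "{..<n} \<times> {..<n}"]) (auto simp: P_def)
  let ?f = "\<lambda>(k, m). block_swap n k m"
  have id_avoids: "avoids_pattern [1..<Suc n] [2, 1, 3]" "avoids_pattern [1..<Suc n] [3, 2, 1]"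
    using block_swap_avoids[of n n n] by (simp_all add: block_swap_same del: upt_Suc)
  have "{v \<in> linear_extensions (comb_carrier s t) (comb_order s t).
           avoids_pattern v [2, 1, 3] \<and> avoids_pattern v [3, 2, 1]} = insert [1..<Suc n] (?f ` P)"
    (is "?L = ?R")
  proof (intro equalityI subsetI)
    fix v assume v: "v \<in> ?L"
    then have "distinct v" "set v = {1..n}"
      by (auto simp: linear_extensions_def comb_carrier_def n_def)
    then consider "v = [1..<Suc n]" | k m where "k < m" "m < n" "v = block_swap n k m"
      using avoiders_are_block_swaps v by blast
    then show "v \<in> ?R"
    proof cases
      case 2
      then have "(k, m) \<in> P"
        using v block_swap_linear_extension_iff[OF assms(2)] by (auto simp: P_def n_def)
      then show ?thesis using 2 by force
    qed simp
  next
    fix v assume "v \<in> ?R"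
    then show "v \<in> ?L"
      using upt_linear_extension[of s t] id_avoids block_swap_avoids
        block_swap_linear_extension_iff[OF assms(2)]
      by (auto simp: P_def n_def simp del: upt_Suc)
  qed
  \<comment> \<open>The identity is not among the exchanges and accounts for the summand 1.\<close>
  moreover have "[1..<Suc n] \<notin> ?f ` P"
    using block_swap_neq_upt by (force simp: P_def simp del: upt_Suc)
  moreover have "inj_on ?f P"
    by (rule inj_on_subset[OF inj_on_block_swap[of n]]) (auto simp: P_def)
  ultimately show ?thesis
    using cardP \<open>finite P\<close> by (simp add: card_image del: upt_Suc)
qed

end
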